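(* There is a generically computable c.e. set $A \subseteq \omega$ which is not coarsely computable.
   Context: $\omega = \{0,1,2,\dots\}$; c.e. means computably enumerable. The density of $S \subseteq \omega$ is $\rho(S) = \lim_{n\to\infty} \frac{|S \cap [0,n]|}{n+1}$, when this limit exists. A generic description of $A$ is a partial function $\Phi$ from $\omega$ to $\{0,1\}$ such that $\Phi(x) = \chi_A(x)$ whenever $\Phi(x)$ is defined and the domain of $\Phi$ has density $1$; here $\chi_A$ is the characteristic function of $A$. $A$ is generically computable if it has a generic description which is a partial computable function. $A$ is coarsely computable if there is a computable set $C \subseteq \omega$ such that the symmetric difference $A \triangle C$ has density $0$. *)

theory Defs
  imports Complex_Main "HOL-Library.Indicator_Function"
begin

text \<open>
  Computability is rendered by Kleene's partial recursive (\<open>\<mu>\<close>-recursive) functions: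
  a datatype of function descriptions with an evaluation relation.
  Arities are enforced by the evaluation rules, so a description applied to an argument
  list of the wrong length has no value. \<open>Zero\<close> is the nullary constant;
  \<open>Comp Zero []\<close> is the constant zero function of every arity.
\<close>

datatype recf =
    Zero
  | Succ
  | Proj nat nat
  | Comp recf "recf list"
  | Prim recf recf
  | Mu recf

inductive computes :: "recf \<Rightarrow> nat list \<Rightarrow> nat \<Rightarrow> bool" where
  zero: "computes Zero [] 0"
| succ: "computes Succ [x] (Suc x)"
| proj: "length xs = n \<Longrightarrow> i < n \<Longrightarrow> computes (Proj n i) xs (xs ! i)"
| comp: "list_all2 (\<lambda>g y. computes g xs y) gs ys \<Longrightarrow> computes f ys z
          \<Longrightarrow> computes (Comp f gs) xs z"
| prim_0: "computes f xs y \<Longrightarrow> computes (Prim f g) (0 # xs) y"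
| prim_Suc: "computes (Prim f g) (n # xs) y \<Longrightarrow> computes g (n # y # xs) z
          \<Longrightarrow> computes (Prim f g) (Suc n # xs) z"
| mu: "computes f (y # xs) 0 \<Longrightarrow> \<forall>z<y. \<exists>w. computes f (z # xs) (Suc w)
          \<Longrightarrow> computes (Mu f) xs y"

inductive_cases computes_cases:
  "computes Zero xs y"
  "computes Succ xs y"
  "computes (Proj n i) xs y"
  "computes (Comp f gs) xs y"
  "computes (Prim f g) (0 # xs) y"
  "computes (Prim f g) (Suc n # xs) y"
  "computes (Mu f) xs y"

lemma computes_functional:
  "computes f xs y \<Longrightarrow> computes f xs y' \<Longrightarrow> y = y'"
proof (induction f xs y arbitrary: y' rule: computes.induct)
  case (comp xs gs ys f z)
  from comp.prems obtain ys' where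
    ys': "list_all2 (\<lambda>g y. computes g xs y) gs ys'" "computes f ys' y'"
    by (rule computes_cases)
  have "ys = ys'"
    using comp.IH(1) ys'(1) unfolding list_all2_conv_all_nth
    by (metis nth_equalityI)
  with comp.IH(2) ys'(2) show ?case by blast
next
  case (prim_0 f xs y g)
  from prim_0.prems have "computes f xs y'" by (rule computes_cases)
  with prim_0.IH show ?case by blast
next
  case (prim_Suc f g n xs y z)
  from prim_Suc.prems obtain u where
    "computes (Prim f g) (n # xs) u" "computes g (n # u # xs) y'"
    by (rule computes_cases)
  with prim_Suc.IH show ?case by blast
next
  case (mu f y xs)
  from mu.prems have y': "computes f (y' # xs) 0"
    "\<forall>z<y'. \<exists>w. computes f (z # xs) (Suc w)"
    by (blast elim: computes_cases(7))+
  have "\<not> y < y'" using mu.IH(1) y'(2) by (metis nat.distinct(1))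
  moreover have "\<not> y' < y" using mu.IH(2) y'(1) by (metis nat.distinct(1))
  ultimately show ?case by simp
qed (erule computes_cases, simp)+

definition partial_computable :: "(nat \<rightharpoonup> nat) \<Rightarrow> bool" where
  "partial_computable \<phi> \<longleftrightarrow> (\<exists>f. \<forall>x y. \<phi> x = Some y \<longleftrightarrow> computes f [x] y)"

definition computable_set :: "nat set \<Rightarrow> bool" where
  "computable_set C \<longleftrightarrow> partial_computable (\<lambda>x. Some (indicator C x))"

definition ce_set :: "nat set \<Rightarrow> bool" where
  "ce_set A \<longleftrightarrow> (\<exists>\<phi>. partial_computable \<phi> \<and> A = dom \<phi>)"

definition has_density :: "nat set \<Rightarrow> real \<Rightarrow> bool" where
  "has_density S d \<longleftrightarrow>
     (\<lambda>n. real (card (S \<inter> {0..n})) / real (n + 1)) \<longlonglongrightarrow> d"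

definition generic_description :: "(nat \<rightharpoonup> nat) \<Rightarrow> nat set \<Rightarrow> bool" where
  "generic_description \<Phi> A \<longleftrightarrow>
     ran \<Phi> \<subseteq> {0, 1} \<and>
     (\<forall>x\<in>dom \<Phi>. \<Phi> x = Some (indicator A x)) \<and>
     has_density (dom \<Phi>) 1"

definition generically_computable :: "nat set \<Rightarrow> bool" where
  "generically_computable A \<longleftrightarrow>
     (\<exists>\<Phi>. generic_description \<Phi> A \<and> partial_computable \<Phi>)"

definition coarsely_computable :: "nat set \<Rightarrow> bool" where
  "coarsely_computable A \<longleftrightarrow>
     (\<exists>C. computable_set C \<and> has_density ((A - C) \<union> (C - A)) 0)"

end

theory Submission
  imports Defs "HOL-Library.Nat_Bijection"
begin

text \<open>
  Cut the positive integers into the dyadic blocks \<open>[2 ^ k, 2 ^ (k + 1))\<close> and read the block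
  number \<open>k\<close> as a pair \<open>(e, t)\<close>: in this block, and only at the multiples of \<open>2 ^ e\<close>, the set
  is used to keep the \<open>e\<close>-th partial computable function \<open>\<phi>\<^sub>e\<close> from describing it coarsely.
  The block takes part only if \<open>t\<close> is a stage at which the initial segment on which \<open>\<phi>\<^sub>e\<close> is known to converge
  becomes longer. In such an active block, a multiple \<open>x\<close> of \<open>2 ^ e\<close> enters the set \<open>A\<close> as soon as
  \<open>\<phi>\<^sub>e(x)\<close> converges to \<open>0\<close>. This makes \<open>A\<close> c.e.

  If \<open>\<phi>\<^sub>e\<close> is the characteristic function of a set \<open>C\<close>, it has infinitely many active stages, and
  \<open>A\<close> disagrees with \<open>C\<close> on a fraction \<open>2 ^ - e\<close> of each active block. As a block makes up half of
  the initial segment that ends with it, the symmetric difference does not have density \<open>0\<close>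
  (\<open>not_coarsely_computable_diag_set\<close>).

  Whether \<open>x\<close> is a multiple of \<open>2 ^ e\<close> in an active block is decidable, so the natural description of
  \<open>A\<close> says no if it is not, and otherwise waits for \<open>\<phi>\<^sub>e(x)\<close>. It is undefined at \<open>x\<close> only if
  \<open>\<phi>\<^sub>e(x)\<close> diverges. But then the convergent initial segment of \<open>\<phi>\<^sub>e\<close> stops growing, so \<open>e\<close> has
  only finitely many active blocks. Hence each \<open>e\<close> accounts for finitely many undefined points, and
  all those of indices \<open>\<ge> e\<close> are multiples of \<open>2 ^ e\<close>: their density is \<open>0\<close>
  (\<open>generically_computable_diag_set\<close>).

  The functions \<open>\<phi>\<^sub>e\<close> have to be listed uniformly. An abstract machine that runs coded descriptions
  does this; its step function is primitive recursive, and \<open>machine_computes\<close> says that it reaches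
  every value which a description computes.
\<close>

section \<open>Total recursive functions\<close>

text \<open>
  The arguments are the first \<open>n\<close> values of an assignment \<open>v\<close>. With functions given as terms in
  \<open>v 0\<close>, \<open>v 1\<close>, and so on, the closure properties below become introduction rules that follow the
  syntax of such a term.
\<close>

definition recursive :: "nat \<Rightarrow> ((nat \<Rightarrow> nat) \<Rightarrow> nat) \<Rightarrow> bool" where
  "recursive n F \<longleftrightarrow> (\<exists>r. \<forall>v. computes r (map v [0..<n]) (F v))"

named_theorems recursive_intros

lemma recursive_var [recursive_intros]:
  assumes "i < n"
  shows "recursive n (\<lambda>v. v i)"
proof -
  have "computes (Proj n i) (map v [0..<n]) (v i)" for v
    using computes.proj[of "map v [0..<n]" n i] assms by simp
  then show ?thesis unfolding recursive_def by blast
qed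

lemma recursive_compose:
  assumes H: "recursive (length Gs) H" and Gs: "\<And>G. G \<in> set Gs \<Longrightarrow> recursive n G"
  shows "recursive n (\<lambda>v. H (\<lambda>i. (Gs ! i) v))"
proof -
  obtain r where r: "\<And>v. computes r (map v [0..<length Gs]) (H v)"
    using H unfolding recursive_def by blast
  obtain rg where rg: "\<And>G v. G \<in> set Gs \<Longrightarrow> computes (rg G) (map v [0..<n]) (G v)"
    using Gs unfolding recursive_def by metis
  have "computes (Comp r (map rg Gs)) (map v [0..<n]) (H (\<lambda>i. (Gs ! i) v))" for v
  proof (rule computes.comp)
    show "list_all2 (\<lambda>g y. computes g (map v [0..<n]) y) (map rg Gs)
        (map (\<lambda>i. (Gs ! i) v) [0..<length Gs])"
      by (auto simp: list_all2_conv_all_nth intro: rg)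
  qed (rule r)
  then show ?thesis unfolding recursive_def by blast
qed

lemma recursive_compose1:
  assumes "recursive 1 (\<lambda>v. h (v 0))" "recursive n F"
  shows "recursive n (\<lambda>v. h (F v))"
  using recursive_compose[of "[F]" "\<lambda>v. h (v 0)" n] assms by simp

lemma recursive_compose2:
  assumes "recursive 2 (\<lambda>v. h (v 0) (v 1))" "recursive n F" "recursive n G"
  shows "recursive n (\<lambda>v. h (F v) (G v))"
  using recursive_compose[of "[F, G]" "\<lambda>v. h (v 0) (v 1)" n] assms
  by (auto simp: numeral_2_eq_2)

lemma recursive_Suc [recursive_intros]:
  assumes "recursive n F"
  shows "recursive n (\<lambda>v. Suc (F v))"
proof (rule recursive_compose1[OF _ assms])
  have "computes Succ (map v [0..<1]) (Suc (v 0))" for v :: "nat \<Rightarrow> nat"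
    using computes.succ by simp
  then show "recursive 1 (\<lambda>v. Suc (v 0))" unfolding recursive_def by blast
qed

lemma recursive_const [recursive_intros]: "recursive n (\<lambda>v. c)"
proof (induction c)
  case 0
  have "computes (Comp Zero []) (map v [0..<n]) 0" for v
    by (rule computes.comp[OF _ computes.zero]) simp
  then show ?case unfolding recursive_def by blast
qed (rule recursive_Suc)

text \<open>
  The step term of a recursion has two more variables, the counter and the previous value. They are
  put in front, where \<open>Prim\<close> passes them; hence the shift of the other variables by two.
\<close>

lemma recursive_rec_nat [recursive_intros]:
  assumes F: "recursive n F" and B: "recursive n B"
    and G: "recursive (Suc (Suc n)) (\<lambda>v. G (v 0) (v 1) (\<lambda>i. v (Suc (Suc i))))"
  shows "recursive n (\<lambda>v. rec_nat (F v) (\<lambda>k a. G k a v) (B v))"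
proof -
  obtain f where f: "\<And>v. computes f (map v [0..<n]) (F v)"
    using F unfolding recursive_def by blast
  obtain g where g: "\<And>v. computes g (map v [0..<Suc (Suc n)])
      (G (v 0) (v 1) (\<lambda>i. v (Suc (Suc i))))"
    using G unfolding recursive_def by blast
  have g': "computes g (k # a # map v [0..<n]) (G k a v)" for k a v
  proof -
    have "map (case_nat k (case_nat a v)) [0..<Suc (Suc n)] = k # a # map v [0..<n]"
      by (simp del: upt_Suc add: upt_conv_Cons map_Suc_upt[symmetric])
    then show ?thesis using g[of "case_nat k (case_nat a v)"] by simp
  qed
  have P: "computes (Prim f g) (b # map v [0..<n]) (rec_nat (F v) (\<lambda>k a. G k a v) b)" for b v
    by (induction b) (auto intro: computes.prim_0 computes.prim_Suc f g')
  obtain b where b: "\<And>v. computes b (map v [0..<n]) (B v)"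
    using B unfolding recursive_def by blast
  have "computes (Comp (Prim f g) (b # map (Proj n) [0..<n])) (map v [0..<n])
      (rec_nat (F v) (\<lambda>k a. G k a v) (B v))" for v
  proof (rule computes.comp[OF _ P])
    show "list_all2 (\<lambda>h y. computes h (map v [0..<n]) y) (b # map (Proj n) [0..<n])
        (B v # map v [0..<n])"
      using computes.proj[of "map v [0..<n]" n]
      by (auto simp: list_all2_conv_all_nth nth_Cons b split: nat.split)
  qed
  then show ?thesis unfolding recursive_def by blast
qed

section \<open>Arithmetic\<close>

lemma recursive_add [recursive_intros]:
  assumes "recursive n F" "recursive n G"
  shows "recursive n (\<lambda>v. F v + G v)"
proof -
  have "x + y = rec_nat x (\<lambda>_ a. Suc a) y" for x y :: nat by (induction y) auto
  then show ?thesis by (simp only:, intro recursive_intros assms) simp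
qed

lemma recursive_mult [recursive_intros]:
  assumes "recursive n F" "recursive n G"
  shows "recursive n (\<lambda>v. F v * G v)"
proof (rule recursive_compose2[OF _ assms])
  have "x * y = rec_nat 0 (\<lambda>_ a. a + x) y" for x y :: nat by (induction y) auto
  then show "recursive 2 (\<lambda>v. v 0 * v 1)" by (simp only:, intro recursive_intros) auto
qed

lemma recursive_power [recursive_intros]:
  assumes "recursive n F" "recursive n G"
  shows "recursive n (\<lambda>v. F v ^ G v)"
proof (rule recursive_compose2[OF _ assms])
  have "x ^ y = rec_nat 1 (\<lambda>_ a. a * x) y" for x y :: nat by (induction y) auto
  then show "recursive 2 (\<lambda>v. v 0 ^ v 1)" by (simp only:, intro recursive_intros) auto
qed

lemma recursive_diff [recursive_intros]:
  assumes "recursive n F" "recursive n G"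
  shows "recursive n (\<lambda>v. F v - G v)"
proof -
  have pred: "rec_nat 0 (\<lambda>k _. k) x = x - 1" for x :: nat by (cases x) auto
  have "x - y = rec_nat x (\<lambda>_. rec_nat 0 (\<lambda>k _. k)) y" for x y :: nat
    by (induction y) (auto simp: pred)
  then show ?thesis by (simp only:, intro recursive_intros assms) auto
qed

text \<open>
  The sum of the two truncated differences vanishes exactly when the numbers are equal, and a
  recursion whose step ignores its arguments tests whether its counter is \<open>0\<close>.
\<close>

lemma recursive_if_eq [recursive_intros]:
  assumes "recursive n F" "recursive n G" "recursive n H" "recursive n K"
  shows "recursive n (\<lambda>v. if F v = G v then H v else K v)"
proof -
  let ?if = "\<lambda>v :: nat \<Rightarrow> nat. if v 0 = v (Suc 0) then v (Suc (Suc 0)) else v (Suc (Suc (Suc 0)))"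
  have "(if x = y then a else b) = rec_nat a (\<lambda>_ _. b) ((x - y) + (y - x))" for x y a b :: nat
    by (cases "(x - y) + (y - x)") auto
  then have "recursive (length [F, G, H, K]) ?if"
    by (simp only:, intro recursive_intros) auto
  from recursive_compose[OF this, of n] show ?thesis using assms by (auto cong: if_cong)
qed

lemma recursive_if_le [recursive_intros]:
  assumes "recursive n F" "recursive n G" "recursive n H" "recursive n K"
  shows "recursive n (\<lambda>v. if F v \<le> G v then H v else K v)"
proof -
  have "(if x \<le> y then a else b) = (if x - y = 0 then a else b)" for x y a b :: nat by simp
  then show ?thesis by (simp only:, intro recursive_intros assms)
qed

lemma recursive_mod [recursive_intros]:
  assumes "recursive n F" "recursive n G"
  shows "recursive n (\<lambda>v. F v mod G v)"
proof (rule recursive_compose2[OF _ assms])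
  have "x mod d = rec_nat 0 (\<lambda>_ a. if Suc a = d then 0 else Suc a) x" for x d :: nat
    by (induction x) (auto simp: mod_Suc)
  then show "recursive 2 (\<lambda>v. v 0 mod v 1)" by (simp only:, intro recursive_intros) auto
qed

text \<open>
  For an increasing \<open>T\<close>, this is the inverse of \<open>T\<close> rounded down, computed by a counter which moves
  on when the next value of \<open>T\<close> has been reached. It yields the root that inverts Cantor's pairing
  function (\<open>T = triangle\<close>) and the binary logarithm (\<open>T k = 2 ^ k\<close>).
\<close>

definition level :: "(nat \<Rightarrow> nat) \<Rightarrow> nat \<Rightarrow> nat" where
  "level T x = rec_nat 0 (\<lambda>k a. if T (Suc a) \<le> Suc k then Suc a else a) x"

text \<open>
  The case \<open>level T x = 0\<close> is listed separately because \<open>x\<close> may lie below \<open>T 0\<close>, as \<open>0\<close> does for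
  the powers of two.
\<close>

lemma level_bounds:
  assumes T: "strict_mono T"
  shows "x < T (Suc (level T x)) \<and> (level T x = 0 \<or> T (level T x) \<le> x)"
proof (induction x)
  case 0
  have "T 0 < T 1" using T by (simp add: strict_mono_less)
  then show ?case by (simp add: level_def)
next
  case (Suc x)
  define l where "l = level T x"
  have "T (Suc l) < T (Suc (Suc l))" using T by (simp add: strict_mono_less)
  moreover have "level T (Suc x) = (if T (Suc l) \<le> Suc x then Suc l else l)"
    by (simp add: level_def l_def)
  ultimately show ?case using Suc.IH by (auto simp: l_def[symmetric])
qed

lemma level_eq:
  assumes T: "strict_mono T" and m: "T m \<le> x" "x < T (Suc m)"
  shows "level T x = m"
proof -
  have "T m < T (Suc (level T x))" using level_bounds[OF T, of x] m by linarith
  then have "m \<le> level T x" using T by (simp add: strict_mono_less)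
  moreover have "level T x \<le> m"
  proof (cases "level T x = 0")
    case False
    then have "T (level T x) < T (Suc m)" using level_bounds[OF T, of x] m by linarith
    then show ?thesis using T by (simp add: strict_mono_less)
  qed simp
  ultimately show ?thesis by simp
qed

lemma recursive_level:
  assumes "recursive 1 (\<lambda>v. T (v 0))" "recursive n F"
  shows "recursive n (\<lambda>v. level T (F v))"
  unfolding level_def by (intro recursive_intros recursive_compose1[OF assms(1)] assms(2)) auto

section \<open>Pairing\<close>

abbreviation pair :: "nat \<Rightarrow> nat \<Rightarrow> nat" where "pair a b \<equiv> prod_encode (a, b)"
abbreviation pfst :: "nat \<Rightarrow> nat" where "pfst n \<equiv> fst (prod_decode n)"
abbreviation psnd :: "nat \<Rightarrow> nat" where "psnd n \<equiv> snd (prod_decode n)"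

lemma recursive_triangle [recursive_intros]:
  assumes "recursive n F"
  shows "recursive n (\<lambda>v. triangle (F v))"
proof -
  have "triangle x = rec_nat 0 (\<lambda>k a. a + Suc k) x" for x by (induction x) auto
  then show ?thesis by (simp only:, intro recursive_intros assms) auto
qed

lemma recursive_pair [recursive_intros]:
  assumes "recursive n F" "recursive n G"
  shows "recursive n (\<lambda>v. pair (F v) (G v))"
  unfolding prod_encode_def by (simp, intro recursive_intros assms)

text \<open>
  The pair \<open>(a, b)\<close> has the code \<open>triangle (a + b) + a\<close>, and \<open>a\<close> is at most \<open>a + b\<close>. So the code
  lies between two consecutive triangular numbers, which determine \<open>a + b\<close>; the remainder is \<open>a\<close>.
\<close>

lemma level_triangle: "level triangle (pair a b) = a + b"
  by (rule level_eq) (auto simp: prod_encode_def strict_mono_Suc_iff)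

lemma pfst_eq: "pfst n = n - triangle (level triangle n)"
proof -
  obtain a b where "n = pair a b" by (metis prod_decode_inverse surj_pair)
  then show ?thesis by (simp add: level_triangle) (simp add: prod_encode_def)
qed

lemma psnd_eq: "psnd n = level triangle n - pfst n"
proof -
  obtain a b where "n = pair a b" by (metis prod_decode_inverse surj_pair)
  then show ?thesis by (simp add: level_triangle)
qed

lemma recursive_pfst [recursive_intros]:
  assumes "recursive n F"
  shows "recursive n (\<lambda>v. pfst (F v))"
  unfolding pfst_eq by (intro recursive_intros recursive_level assms) auto

lemma recursive_psnd [recursive_intros]:
  assumes "recursive n F"
  shows "recursive n (\<lambda>v. psnd (F v))"
  unfolding psnd_eq by (intro recursive_intros recursive_level assms) auto

section \<open>A universal machine\<close>

text \<open>
  A state of the machine consists of an instruction, the list of its arguments and a stack of frames,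
  all coded by numbers so that lists have the codes of \<open>list_encode\<close>. An instruction is a description
  of a function, with some extra fields that record how far its evaluation has come; tag \<open>6\<close> marks a
  value that is being returned. A frame is an instruction that waits for a value, together with the
  arguments with which it continues.
\<close>

abbreviation lcons :: "nat \<Rightarrow> nat \<Rightarrow> nat" where "lcons x l \<equiv> Suc (pair x l)"
definition lhd :: "nat \<Rightarrow> nat" where "lhd l = pfst (l - 1)"
definition ltl :: "nat \<Rightarrow> nat" where "ltl l = psnd (l - 1)"

lemma lhd_lcons [simp]: "lhd (lcons x l) = x" by (simp add: lhd_def)
lemma ltl_lcons [simp]: "ltl (lcons x l) = l" by (simp add: ltl_def)

definition instr :: "nat \<Rightarrow> nat \<Rightarrow> nat \<Rightarrow> nat \<Rightarrow> nat" where
  "instr t a b d = pair t (pair a (pair b d))"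
definition tag :: "nat \<Rightarrow> nat" where "tag c = pfst c"
definition arg1 :: "nat \<Rightarrow> nat" where "arg1 c = pfst (psnd c)"
definition arg2 :: "nat \<Rightarrow> nat" where "arg2 c = pfst (psnd (psnd c))"
definition arg3 :: "nat \<Rightarrow> nat" where "arg3 c = psnd (psnd (psnd c))"

lemma instr_sel [simp]:
  "tag (instr t a b d) = t" "arg1 (instr t a b d) = a"
  "arg2 (instr t a b d) = b" "arg3 (instr t a b d) = d"
  by (simp_all add: instr_def tag_def arg1_def arg2_def arg3_def)

definition state :: "nat \<Rightarrow> nat \<Rightarrow> nat \<Rightarrow> nat" where
  "state c xs K = pair c (pair xs K)"

definition ret :: "nat \<Rightarrow> nat \<Rightarrow> nat" where
  "ret y K = state (instr 6 y 0 0) 0 K"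

text \<open>
  The frame \<open>(c, xs)\<close> receives the value \<open>y\<close>. A composition adds \<open>y\<close> to the argument values found
  so far. A primitive recursion, whose frame keeps the successor of the counter in front of \<open>xs\<close>,
  applies its step function to the counter and \<open>y\<close>. A minimization returns its present
  candidate if \<open>y = 0\<close> and tries the next candidate otherwise.
\<close>

definition resume :: "nat \<Rightarrow> nat \<Rightarrow> nat \<Rightarrow> nat \<Rightarrow> nat" where
  "resume y c xs K =
    (if tag c = 3 then state (instr 3 (arg1 c) (arg2 c) (lcons y (arg3 c))) xs K
     else if tag c = 4 then state (arg2 c) (lcons (lhd xs - 1) (lcons y (ltl xs))) K
     else if y = 0 then ret (arg2 c) K
     else state (instr 5 (arg1 c) (Suc (arg2 c)) 0) xs K)"

text \<open>
  The tags \<open>0\<close> to \<open>5\<close> are those of \<open>code\<close> below. A projection walks down the argument list. In a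
  composition, \<open>arg2\<close> lists the inner functions still to be evaluated and \<open>arg3\<close> the values
  found; in a minimization, \<open>arg2\<close> is the present candidate. A value that meets the empty stack is
  final, and the state stays as it is.
\<close>

definition exec :: "nat \<Rightarrow> nat \<Rightarrow> nat \<Rightarrow> nat" where
  "exec c xs K =
    (if tag c = 0 then ret 0 K
     else if tag c = 1 then ret (Suc (lhd xs)) K
     else if tag c = 2 then
       (if arg1 c = 0 then ret (lhd xs) K else state (instr 2 (arg1 c - 1) 0 0) (ltl xs) K)
     else if tag c = 3 then
       (if arg2 c = 0 then state (arg1 c) (arg3 c) K
        else state (lhd (arg2 c)) xs
          (lcons (pair (instr 3 (arg1 c) (ltl (arg2 c)) (arg3 c)) xs) K))
     else if tag c = 4 then
       (if lhd xs = 0 then state (arg1 c) (ltl xs) K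
        else state c (lcons (lhd xs - 1) (ltl xs)) (lcons (pair c xs) K))
     else if tag c = 5 then state (arg1 c) (lcons (arg2 c) xs) (lcons (pair c xs) K)
     else if K = 0 then state c xs K
     else resume (arg1 c) (pfst (lhd K)) (psnd (lhd K)) (ltl K))"

definition step :: "nat \<Rightarrow> nat" where
  "step s = exec (pfst s) (pfst (psnd s)) (psnd (psnd s))"

lemma step_state [simp]: "step (state c xs K) = exec c xs K"
  by (simp add: step_def state_def)

text \<open>
  The inner functions of a composition are evaluated from last to first, since the values are
  collected by adding to the front of a list.
\<close>

fun code :: "recf \<Rightarrow> nat" where
  "code Zero = instr 0 0 0 0"
| "code Succ = instr 1 0 0 0"
| "code (Proj n i) = instr 2 i 0 0"
| "code (Comp f gs) = instr 3 (code f) (list_encode (map code (rev gs))) 0"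
| "code (Prim f g) = instr 4 (code f) (code g) 0"
| "code (Mu f) = instr 5 (code f) 0 0"


definition reaches :: "nat \<Rightarrow> nat \<Rightarrow> bool" where
  "reaches s t \<longleftrightarrow> (\<exists>n. (step ^^ n) s = t)"

lemma reaches_refl: "reaches s s"
  unfolding reaches_def by (rule exI[of _ 0]) simp

lemma reaches_step: "reaches (step s) t \<Longrightarrow> reaches s t"
  unfolding reaches_def by (metis funpow_simps_right(2) comp_apply)

lemma reaches_trans:
  assumes "reaches s t" "reaches t u"
  shows "reaches s u"
proof -
  obtain m n where "(step ^^ m) s = t" "(step ^^ n) t = u"
    using assms unfolding reaches_def by blast
  then have "(step ^^ (n + m)) s = u" by (simp add: funpow_add)
  then show ?thesis unfolding reaches_def by blast
qed

lemma reaches_stateI: "reaches (exec c xs K) t \<Longrightarrow> reaches (state c xs K) t"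
  by (rule reaches_step) simp

lemma reaches_ret:
  "reaches (resume y (pfst fr) (psnd fr) K) t \<Longrightarrow> reaches (ret y (lcons fr K)) t"
  unfolding ret_def by (rule reaches_stateI) (simp add: exec_def)

lemma reaches_comp:
  assumes "list_all2 (\<lambda>g y. \<forall>K. reaches (state (code g) xs K) (ret y K)) gs ys"
  shows "reaches (state (instr 3 f (list_encode (map code gs)) (list_encode acc)) xs K)
           (state f (list_encode (rev ys @ acc)) K)"
  using assms
proof (induction gs ys arbitrary: acc rule: list_all2_induct)
  case Nil
  show ?case by (rule reaches_stateI) (simp add: exec_def reaches_refl)
next
  case (Cons g gs y ys)
  let ?K = "lcons (pair (instr 3 f (list_encode (map code gs)) (list_encode acc)) xs) K"
  have "reaches (ret y ?K) (state f (list_encode (rev ys @ y # acc)) K)"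
    by (rule reaches_ret) (use Cons.IH[of "y # acc"] in \<open>simp add: resume_def\<close>)
  with Cons.hyps have "reaches (state (code g) xs ?K) (state f (list_encode (rev ys @ y # acc)) K)"
    by (blast intro: reaches_trans)
  then show ?case by (intro reaches_stateI) (simp add: exec_def)
qed

text \<open>
  The stack \<open>K\<close> is arbitrary: a subcomputation runs on top of the frame of its caller, and
  returns its value to that frame. The proof follows the evaluation.
\<close>

theorem machine_computes:
  "computes f xs y \<Longrightarrow> reaches (state (code f) (list_encode xs) K) (ret y K)"
proof (induction f xs y arbitrary: K rule: computes.induct)
  case zero
  show ?case by (rule reaches_stateI) (simp add: exec_def reaches_refl)
next
  case (succ x)
  show ?case by (rule reaches_stateI) (simp add: exec_def reaches_refl)
next
  case (proj xs n i)
  have "reaches (state (instr 2 i 0 0) (list_encode xs) K) (ret (xs ! i) K)" if "i < length xs"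
    using that
  proof (induction i arbitrary: xs)
    case 0
    then show ?case
      by (cases xs) (auto intro!: reaches_stateI simp: exec_def reaches_refl)
  next
    case (Suc i)
    then obtain x xs' where "xs = x # xs'" "i < length xs'" by (cases xs) auto
    with Suc.IH[of xs'] show ?case by (intro reaches_stateI) (simp add: exec_def)
  qed
  with proj show ?case by simp
next
  case (comp xs gs ys f z)
  have "list_all2 (\<lambda>g y. \<forall>K. reaches (state (code g) (list_encode xs) K) (ret y K))
      (rev gs) (rev ys)"
    using comp.IH(1) by (auto elim: list_all2_mono)
  from reaches_comp[OF this, of "code f" "[]" K] comp.IH(2)[of K]
  show ?case by (auto simp: rev_map intro: reaches_trans)
next
  case (prim_0 f xs y g)
  then show ?case by (intro reaches_stateI) (simp add: exec_def)
next
  case (prim_Suc f g n xs y z)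
  let ?K = "lcons (pair (code (Prim f g)) (list_encode (Suc n # xs))) K"
  have "reaches (ret y ?K) (ret z K)"
    by (rule reaches_ret) (use prim_Suc.IH(2)[of K] in \<open>simp add: resume_def\<close>)
  with prim_Suc.IH(1)[of ?K]
  have "reaches (state (code (Prim f g)) (list_encode (n # xs)) ?K) (ret z K)"
    by (rule reaches_trans)
  then show ?case by (intro reaches_stateI) (simp add: exec_def)
next
  case (mu f y xs)
  let ?K = "\<lambda>z. lcons (pair (instr 5 (code f) z 0) (list_encode xs)) K"
  \<comment> \<open>The search succeeds from every candidate up to the least zero; go down from it to the candidate 0.\<close>
  have "reaches (state (instr 5 (code f) z 0) (list_encode xs) K) (ret y K)" if "z \<le> y" for z
    using that
  proof (induction rule: inc_induct)
    case base
    have "reaches (ret 0 (?K y)) (ret y K)"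
      by (rule reaches_ret) (simp add: resume_def reaches_refl)
    with mu.IH(1)[of "?K y"] show ?case
      by (intro reaches_stateI) (simp add: exec_def, blast intro: reaches_trans)
  next
    case (step z)
    obtain w where w: "\<And>K. reaches (state (code f) (list_encode (z # xs)) K) (ret (Suc w) K)"
      using mu.IH(2) step.hyps by blast
    have "reaches (ret (Suc w) (?K z)) (ret y K)"
      by (rule reaches_ret) (use step.IH in \<open>simp add: resume_def\<close>)
    with w[of "?K z"] show ?case
      by (intro reaches_stateI) (simp add: exec_def, blast intro: reaches_trans)
  qed
  from this[of 0] show ?case by simp
qed

lemma recursive_lhd [recursive_intros]: "recursive n F \<Longrightarrow> recursive n (\<lambda>v. lhd (F v))"
  unfolding lhd_def by (intro recursive_intros)

lemma recursive_ltl [recursive_intros]: "recursive n F \<Longrightarrow> recursive n (\<lambda>v. ltl (F v))"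
  unfolding ltl_def by (intro recursive_intros)

lemma recursive_instr [recursive_intros]:
  assumes "recursive n F" "recursive n G" "recursive n H" "recursive n K"
  shows "recursive n (\<lambda>v. instr (F v) (G v) (H v) (K v))"
  unfolding instr_def by (intro recursive_intros assms)

lemma recursive_tag [recursive_intros]: "recursive n F \<Longrightarrow> recursive n (\<lambda>v. tag (F v))"
  unfolding tag_def by (intro recursive_intros)

lemma recursive_arg1 [recursive_intros]: "recursive n F \<Longrightarrow> recursive n (\<lambda>v. arg1 (F v))"
  unfolding arg1_def by (intro recursive_intros)

lemma recursive_arg2 [recursive_intros]: "recursive n F \<Longrightarrow> recursive n (\<lambda>v. arg2 (F v))"
  unfolding arg2_def by (intro recursive_intros)

lemma recursive_arg3 [recursive_intros]: "recursive n F \<Longrightarrow> recursive n (\<lambda>v. arg3 (F v))"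
  unfolding arg3_def by (intro recursive_intros)

lemma recursive_state [recursive_intros]:
  assumes "recursive n F" "recursive n G" "recursive n H"
  shows "recursive n (\<lambda>v. state (F v) (G v) (H v))"
  unfolding state_def by (intro recursive_intros assms)

lemma recursive_step [recursive_intros]:
  assumes "recursive n F"
  shows "recursive n (\<lambda>v. step (F v))"
  unfolding step_def exec_def resume_def ret_def by (intro recursive_intros assms)

definition run :: "nat \<Rightarrow> nat \<Rightarrow> nat \<Rightarrow> nat" where
  "run e x s = (step ^^ s) (state e (lcons x 0) 0)"

text \<open>
  What is known after \<open>s\<close> steps about the value at \<open>x\<close> of the function with code \<open>e\<close>: \<open>0\<close> says that
  the machine has not halted, and \<open>Suc y\<close> that it has returned \<open>y\<close>. Numbers \<open>e\<close> which code no
  description are run as well.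
\<close>

definition outcome :: "nat \<Rightarrow> nat \<Rightarrow> nat \<Rightarrow> nat" where
  "outcome e x s =
    (let c = pfst (run e x s) in
     if psnd (psnd (run e x s)) = 0 then if tag c = 6 then Suc (arg1 c) else 0 else 0)"

lemma recursive_outcome [recursive_intros]:
  assumes "recursive n F" "recursive n G" "recursive n H"
  shows "recursive n (\<lambda>v. outcome (F v) (G v) (H v))"
proof -
  have "run e x s = rec_nat (state e (lcons x 0) 0) (\<lambda>_. step) s" for e x s
    unfolding run_def by (induction s) auto
  then show ?thesis
    unfolding outcome_def Let_def by (simp only:, intro recursive_intros assms) auto
qed

text \<open>
  A state with an empty stack and a returned value is a fixed point of \<open>step\<close>.
\<close>

lemma outcome_mono:
  assumes "outcome e x s \<noteq> 0" "s \<le> t"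
  shows "outcome e x t = outcome e x s"
proof -
  define c where "c = pfst (run e x s)"
  define xs where "xs = pfst (psnd (run e x s))"
  have c: "tag c = 6" "psnd (psnd (run e x s)) = 0"
    using assms(1) by (auto simp: outcome_def c_def Let_def split: if_splits)
  have run: "run e x s = state c xs 0"
    by (metis c(2) c_def xs_def prod.collapse prod_decode_inverse state_def)
  have fixpt: "step (run e x s) = run e x s"
    using c by (simp add: run exec_def)
  have "run e x t = run e x s" using assms(2)
  proof (induction t rule: dec_induct)
    case (step t)
    then show ?case using fixpt by (simp add: run_def)
  qed simp
  then show ?thesis by (simp add: outcome_def)
qed

lemma outcome_computes:
  assumes "computes f [x] y"
  shows "\<exists>s. outcome (code f) x s = Suc y"
proof -
  obtain s where "(step ^^ s) (state (code f) (list_encode [x]) 0) = ret y 0"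
    using machine_computes[OF assms, of 0] unfolding reaches_def by blast
  then have "run (code f) x s = ret y 0" by (simp add: run_def)
  then have "outcome (code f) x s = Suc y"
    by (simp add: outcome_def ret_def state_def)
  then show ?thesis by blast
qed

section \<open>Unbounded search\<close>

text \<open>
  The search for \<open>s\<close> is the only unbounded operation in the construction; the value is then computed
  from the least \<open>s\<close> that was found.
\<close>

lemma partial_computable_search:
  assumes P: "recursive 2 (\<lambda>v. P (v 0) (v 1))" and G: "recursive 2 (\<lambda>v. G (v 0) (v 1))"
  shows "partial_computable
    (\<lambda>x. if \<exists>s. P s x = 0 then Some (G (LEAST s. P s x = 0) x) else None)"
proof -
  have vec: "map (case_nat s (\<lambda>_. x)) [0..<2] = [s, x]" for s x :: nat
    by (simp add: numeral_2_eq_2)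
  obtain p where "\<And>v. computes p (map v [0..<2]) (P (v 0) (v 1))"
    using P unfolding recursive_def by blast
  from this[of "case_nat s (\<lambda>_. x)" for s x] have p: "computes p [s, x] (P s x)" for s x
    unfolding vec by simp
  obtain g where "\<And>v. computes g (map v [0..<2]) (G (v 0) (v 1))"
    using G unfolding recursive_def by blast
  from this[of "case_nat s (\<lambda>_. x)" for s x] have g: "computes g [s, x] (G s x)" for s x
    unfolding vec by simp
  have mu: "computes (Mu p) [x] (LEAST s. P s x = 0)" if "\<exists>s. P s x = 0" for x
  proof (rule computes.mu)
    show "computes p [LEAST s. P s x = 0, x] 0"
      using p[of "LEAST s. P s x = 0" x] LeastI_ex[OF that] by simp
    show "\<forall>z<LEAST s. P s x = 0. \<exists>w. computes p [z, x] (Suc w)"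
      by (metis p not_less_Least not0_implies_Suc)
  qed
  let ?r = "Comp g [Mu p, Proj 1 0]"
  have "computes ?r [x] (G (LEAST s. P s x = 0) x)" if "\<exists>s. P s x = 0" for x
    using mu[OF that] computes.proj[of "[x]" 1 0] by (intro computes.comp[OF _ g]) simp
  moreover have "\<exists>s. P s x = 0" if "computes ?r [x] y" for x y
  proof -
    from that obtain s where "computes (Mu p) [x] s"
      by (auto elim!: computes_cases(4) simp: list_all2_Cons1)
    then have "computes p [s, x] 0" by (auto elim: computes_cases(7))
    then show ?thesis using p computes_functional by blast
  qed
  ultimately have "(if \<exists>s. P s x = 0 then Some (G (LEAST s. P s x = 0) x) else None) = Some y
      \<longleftrightarrow> computes ?r [x] y" for x y
    using computes_functional by (metis option.distinct(1) option.inject)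
  then show ?thesis unfolding partial_computable_def by blast
qed

section \<open>Density\<close>

lemma has_density_Compl:
  assumes "has_density (- S) 0"
  shows "has_density S 1"
proof -
  have "real (card (S \<inter> {0..n})) / real (n + 1) = 1 - real (card (- S \<inter> {0..n})) / real (n + 1)" for n
  proof -
    have "card (S \<inter> {0..n}) + card (- S \<inter> {0..n}) = card ((S \<inter> {0..n}) \<union> (- S \<inter> {0..n}))"
      by (rule card_Un_disjoint[symmetric]) auto
    also have "(S \<inter> {0..n}) \<union> (- S \<inter> {0..n}) = {0..n}" by auto
    finally have "real (card (S \<inter> {0..n})) + real (card (- S \<inter> {0..n})) = real (n + 1)"
      by (simp flip: of_nat_add)
    then show ?thesis by (simp add: field_simps)
  qed
  then show ?thesis
    using tendsto_diff[OF tendsto_const[of 1] assms[unfolded has_density_def]]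
    unfolding has_density_def by simp
qed

text \<open>
  Up to \<open>n\<close> there are about \<open>n / 2 ^ e\<close> multiples of \<open>2 ^ e\<close>, and finitely many other elements do not
  influence the density; so the upper density of \<open>S\<close> is at most \<open>2 ^ - e\<close> for every \<open>e\<close>.
\<close>

lemma has_density_zeroI:
  fixes S :: "nat set"
  assumes "\<And>e. finite (S - {x. 2 ^ e dvd x})"
  shows "has_density S 0"
  unfolding has_density_def
proof (rule LIMSEQ_I)
  fix r :: real
  assume r: "0 < r"
  obtain e where e: "(1 / 2) ^ e < r / 2"
    using real_arch_pow_inv[of "r / 2" "1 / 2"] r by auto
  define c where "c = card (S - {x. 2 ^ e dvd x}) + 1"
  have count: "card (S \<inter> {0..n}) \<le> c + n div 2 ^ e" for n
  proof -
    have "S \<inter> {0..n} \<subseteq> (S - {x. 2 ^ e dvd x}) \<union> (\<lambda>j. 2 ^ e * j) ` {0..n div 2 ^ e}"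
      by (auto simp: dvd_def image_iff less_eq_div_iff_mult_less_eq mult.commute)
    then have "card (S \<inter> {0..n})
        \<le> card ((S - {x. 2 ^ e dvd x}) \<union> (\<lambda>j. 2 ^ e * j) ` {0..n div 2 ^ e})"
      using assms by (intro card_mono) auto
    also have "\<dots> \<le> card (S - {x. 2 ^ e dvd x}) + card ((\<lambda>j. 2 ^ e * j) ` {0..n div 2 ^ e})"
      by (rule card_Un_le)
    also have "\<dots> \<le> card (S - {x. 2 ^ e dvd x}) + card {0..n div 2 ^ e}"
      by (intro add_left_mono card_image_le) simp
    finally show ?thesis by (simp add: c_def)
  qed
  obtain N where N: "real c / (r / 2) < real N" using reals_Archimedean2 by blast
  have "norm (real (card (S \<inter> {0..n})) / real (n + 1) - 0) < r" if n: "n \<ge> N" for n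
  proof -
    have "real (n div 2 ^ e) \<le> real n * (1 / 2) ^ e"
      using of_nat_div_le_of_nat[of n "2 ^ e", where ?'a = real] by (simp add: power_divide)
    also have "\<dots> \<le> real (n + 1) * (r / 2)" using e by (intro mult_mono) auto
    finally have "real (n div 2 ^ e) \<le> real (n + 1) * (r / 2)" .
    moreover have "real c < real (n + 1) * (r / 2)"
    proof -
      have "real c < real N * (r / 2)" using N r by (simp add: field_simps)
      also have "\<dots> \<le> real (n + 1) * (r / 2)" using n r by (intro mult_right_mono) auto
      finally show ?thesis .
    qed
    moreover have "real (card (S \<inter> {0..n})) \<le> real c + real (n div 2 ^ e)"
      using count[of n] by (simp flip: of_nat_add)
    ultimately have "real (card (S \<inter> {0..n})) < real (n + 1) * r" by simp
    then show ?thesis by (simp add: field_simps)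
  qed
  then show "\<exists>N. \<forall>n\<ge>N. norm (real (card (S \<inter> {0..n})) / real (n + 1) - 0) < r" by blast
qed

text \<open>
  The block \<open>[2 ^ k, 2 ^ (k + 1))\<close> contains \<open>2 ^ (k - e)\<close> multiples of \<open>2 ^ e\<close>. Among the
  \<open>2 ^ (k + 1)\<close> numbers up to its end this is the fraction \<open>2 ^ - (e + 1)\<close>, for all \<open>k \<ge> e\<close>.
\<close>

lemma not_has_density_zeroI:
  fixes S :: "nat set"
  assumes "\<And>N. \<exists>k\<ge>N. {x. 2 ^ k \<le> x \<and> x < 2 ^ Suc k \<and> 2 ^ e dvd x} \<subseteq> S"
  shows "\<not> has_density S 0"
proof
  assume "has_density S 0"
  then obtain N where N: "\<And>n. n \<ge> N \<Longrightarrow>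
      norm (real (card (S \<inter> {0..n})) / real (n + 1) - 0) < 1 / 2 ^ Suc e"
    unfolding has_density_def using LIMSEQ_D[of _ 0 "1 / 2 ^ Suc e"] by fastforce
  obtain k where k: "k \<ge> max N e" "{x. 2 ^ k \<le> x \<and> x < 2 ^ Suc k \<and> 2 ^ e dvd x} \<subseteq> S"
    using assms by blast
  define n :: nat where "n = 2 ^ Suc k - 1"
  have n: "n + 1 = 2 ^ Suc k" by (simp add: n_def)
  have "k < 2 ^ k" by (rule less_exp)
  moreover have "N \<le> k" "n + 1 = 2 * 2 ^ k" using k(1) n by simp_all
  ultimately have "N \<le> n" by linarith
  have split: "(2 :: nat) ^ k = 2 ^ e * 2 ^ (k - e)"
    using k(1) by (simp flip: power_add)
  define M :: "nat set" where "M = (\<lambda>j. 2 ^ e * j) ` {2 ^ (k - e)..<2 * 2 ^ (k - e)}"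
  have "M \<subseteq> S \<inter> {0..n}"
  proof
    fix x :: nat
    assume "x \<in> M"
    then obtain j where j: "x = 2 ^ e * j" "2 ^ (k - e) \<le> j" "j < 2 * 2 ^ (k - e)"
      unfolding M_def by auto
    have "2 ^ k \<le> x" using j by (simp add: split)
    moreover have "x < 2 ^ Suc k" using j by (simp add: split)
    moreover have "2 ^ e dvd x" using j by simp
    moreover have "x \<le> n" using \<open>x < 2 ^ Suc k\<close> n by linarith
    ultimately show "x \<in> S \<inter> {0..n}" using k(2) by auto
  qed
  then have "card M \<le> card (S \<inter> {0..n})"
    by (intro card_mono) auto
  moreover have "card M = 2 ^ (k - e)"
    unfolding M_def by (subst card_image) (auto intro: inj_onI)
  ultimately have "(2 :: nat) ^ (k - e) \<le> card (S \<inter> {0..n})" by simp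
  then have le: "(2 :: real) ^ (k - e) \<le> real (card (S \<inter> {0..n}))"
    using of_nat_mono[where 'a = real] by fastforce
  have "n + 1 = 2 ^ Suc e * 2 ^ (k - e)" using n split by simp
  then have "real (n + 1) = real (2 ^ Suc e * 2 ^ (k - e))" by (simp only:)
  then have "real (n + 1) = 2 ^ Suc e * 2 ^ (k - e)" by simp
  then have "1 / 2 ^ Suc e \<le> real (card (S \<inter> {0..n})) / real (n + 1)"
    using le by (simp add: field_simps)
  then show False using N[OF \<open>N \<le> n\<close>] by simp
qed

section \<open>The diagonal set\<close>

text \<open>
  A lower bound, known at stage \<open>t\<close>, for the length of the initial segment on which the function with
  code \<open>e\<close> converges. Each stage only asks whether the next argument has converged by now and
  lengthens the segment by at most one. The active stages are those at which it grows, which makes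
  activity decidable.
\<close>

definition progress :: "nat \<Rightarrow> nat \<Rightarrow> nat" where
  "progress e t = rec_nat 0 (\<lambda>t l. if outcome e l t = 0 then l else Suc l) t"

definition active :: "nat \<Rightarrow> nat \<Rightarrow> bool" where
  "active e t \<longleftrightarrow> outcome e (progress e t) t \<noteq> 0"

lemma progress_Suc: "progress e (Suc t) = (if active e t then Suc (progress e t) else progress e t)"
  by (simp add: progress_def active_def)

lemma progress_mono: "s \<le> t \<Longrightarrow> progress e s \<le> progress e t"
  by (induction rule: dec_induct) (auto simp: progress_Suc)

text \<open>
  The segment never gets past an argument without a value, and it grows at every active stage.
\<close>

lemma finite_active:
  assumes "\<forall>s. outcome e x s = 0"
  shows "finite {t. active e t}"
proof (rule finite_imageD)
  have "progress e t \<le> x" for t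
  proof (induction t)
    case 0
    show ?case by (simp add: progress_def)
  next
    case (Suc t)
    show ?case
    proof (cases "progress e t = x")
      case True
      with assms show ?thesis by (simp add: progress_Suc active_def)
    next
      case False
      with Suc.IH show ?thesis by (simp add: progress_Suc)
    qed
  qed
  then show "finite (progress e ` {t. active e t})"
    by (auto intro: finite_subset[of _ "{..x}"])
  show "inj_on (progress e) {t. active e t}"
  proof (rule linorder_inj_onI)
    fix s t
    assume "s < t" "s \<in> {t. active e t}"
    then have "Suc (progress e s) \<le> progress e t"
      using progress_mono[of "Suc s" t e] by (simp add: progress_Suc)
    then show "progress e s \<noteq> progress e t" by simp
  qed auto
qed

text \<open>
  Without active stages from \<open>N\<close> on, the segment would keep its length \<open>l\<close>. But the computation at \<open>l\<close>
  halts, and any later stage is then active.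
\<close>

lemma infinite_active:
  assumes "\<And>x. \<exists>s. outcome e x s \<noteq> 0"
  shows "\<exists>t\<ge>N. active e t"
proof (rule ccontr)
  assume none: "\<not> ?thesis"
  define l where "l = progress e N"
  have const: "progress e t = l" if "t \<ge> N" for t
    using that by (induction rule: dec_induct) (use none in \<open>auto simp: l_def progress_Suc\<close>)
  obtain s where s: "outcome e l s \<noteq> 0" using assms by blast
  have "outcome e l (max s N) \<noteq> 0" using outcome_mono[OF s, of "max s N"] s by simp
  then have "active e (max s N)" by (simp add: active_def const)
  with none show False by auto
qed

text \<open>
  The block of \<open>x\<close> names an index \<open>e\<close> and a stage \<open>t\<close>. An active block is used at multiples of
  \<open>2 ^ e\<close> only, so that the requirements with large indices affect a set of small density.
\<close>

definition block :: "nat \<Rightarrow> nat" where "block x = level (\<lambda>k. 2 ^ k) x"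
definition index :: "nat \<Rightarrow> nat" where "index x = pfst (block x)"
definition stage :: "nat \<Rightarrow> nat" where "stage x = psnd (block x)"

definition candidate :: "nat \<Rightarrow> bool" where
  "candidate x \<longleftrightarrow> 2 ^ index x dvd x \<and> active (index x) (stage x)"

text \<open>
  The outcome \<open>1\<close> stands for the value \<open>0\<close>: a candidate point is put into the set exactly when the
  function with code \<open>index x\<close> rejects it.
\<close>

definition diag_set :: "nat set" where
  "diag_set = {x. candidate x \<and> (\<exists>s. outcome (index x) x s = 1)}"

lemma strict_mono_pow2: "strict_mono (\<lambda>k. 2 ^ k :: nat)"
  by (simp add: strict_mono_def)

lemma block_eq: "2 ^ k \<le> x \<Longrightarrow> x < 2 ^ Suc k \<Longrightarrow> block x = k"
  unfolding block_def by (rule level_eq[OF strict_mono_pow2])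

lemma finite_block: "finite {x. block x = k}"
proof (rule finite_subset)
  show "{x. block x = k} \<subseteq> {..<2 ^ Suc k}"
    using level_bounds[OF strict_mono_pow2] by (auto simp: block_def)
qed simp

lemma recursive_block [recursive_intros]:
  assumes "recursive n F"
  shows "recursive n (\<lambda>v. block (F v))"
  unfolding block_def by (intro recursive_intros recursive_level assms) auto

lemma recursive_index [recursive_intros]: "recursive n F \<Longrightarrow> recursive n (\<lambda>v. index (F v))"
  unfolding index_def by (intro recursive_intros)

lemma recursive_stage [recursive_intros]: "recursive n F \<Longrightarrow> recursive n (\<lambda>v. stage (F v))"
  unfolding stage_def by (intro recursive_intros)

lemma recursive_progress [recursive_intros]:
  assumes "recursive n F" "recursive n G"
  shows "recursive n (\<lambda>v. progress (F v) (G v))"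
proof (rule recursive_compose2[OF _ assms])
  show "recursive 2 (\<lambda>v. progress (v 0) (v 1))"
    unfolding progress_def by (intro recursive_intros) auto
qed

lemma recursive_if_candidate [recursive_intros]:
  assumes "recursive n F" "recursive n G" "recursive n H"
  shows "recursive n (\<lambda>v. if candidate (F v) then G v else H v)"
proof -
  have "(if candidate x then a else b) =
      (if x mod 2 ^ index x = 0 then
         if outcome (index x) (progress (index x) (stage x)) (stage x) = 0 then b else a
       else b)" for x and a b :: nat
    by (auto simp: candidate_def active_def mod_eq_0_iff_dvd)
  then show ?thesis by (simp only:, intro recursive_intros assms)
qed

text \<open>
  Once the machine has halted, its outcome decides membership in \<open>diag_set\<close>: by monotonicity, all
  nonzero outcomes agree.
\<close>

lemma outcome_eq_unique:
  assumes "outcome e x s \<noteq> 0"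
  shows "(\<exists>t. outcome e x t = 1) \<longleftrightarrow> outcome e x s = 1"
proof
  assume "\<exists>t. outcome e x t = 1"
  then obtain t where t: "outcome e x t = 1" by blast
  show "outcome e x s = 1"
  proof (cases "s \<le> t")
    case True
    then show ?thesis using outcome_mono[OF assms True] t by metis
  next
    case False
    then show ?thesis using outcome_mono[of e x t s] t by auto
  qed
qed blast

lemma ce_diag_set: "ce_set diag_set"
proof -
  define P where "P s x = (if candidate x then if outcome (index x) x s = 1 then 0 else 1 else 1 :: nat)"
    for s x
  have "partial_computable (\<lambda>x. if \<exists>s. P s x = 0 then Some 0 else None)"
  proof (rule partial_computable_search)
    show "recursive 2 (\<lambda>v. P (v 0) (v 1))"
      unfolding P_def by (intro recursive_intros) auto
  qed (rule recursive_const)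
  moreover have "dom (\<lambda>x. if \<exists>s. P s x = 0 then Some 0 else None) = diag_set"
    by (auto simp: dom_def diag_set_def P_def split: if_splits)
  ultimately show ?thesis unfolding ce_set_def by blast
qed

text \<open>
  The points at which the generic description, which waits for the computation at a candidate, is
  undefined.
\<close>

definition undecided :: "nat set" where
  "undecided = {x. candidate x \<and> (\<forall>s. outcome (index x) x s = 0)}"

text \<open>
  An undecided point shows that the function with code \<open>e\<close> is partial. Then \<open>e\<close> has finitely many
  active stages, each of which belongs to one finite block.
\<close>

lemma finite_undecided: "finite {x \<in> undecided. index x = e}"
proof (cases "\<exists>x. \<forall>s. outcome e x s = 0")
  case True
  then have "finite {t. active e t}" using finite_active by blast
  then have "finite (\<Union>t\<in>{t. active e t}. {x. block x = pair e t})"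
    using finite_block by blast
  moreover have "{x \<in> undecided. index x = e} \<subseteq> (\<Union>t\<in>{t. active e t}. {x. block x = pair e t})"
    by (auto simp: undecided_def candidate_def index_def stage_def)
  ultimately show ?thesis by (rule rev_finite_subset)
next
  case False
  then have "{x \<in> undecided. index x = e} = {}" by (auto simp: undecided_def)
  then show ?thesis by (simp only: finite.emptyI)
qed

lemma density_undecided: "has_density undecided 0"
proof (rule has_density_zeroI)
  fix e
  have "undecided - {x. 2 ^ e dvd x} \<subseteq> (\<Union>d<e. {x \<in> undecided. index x = d})"
  proof
    fix x
    assume x: "x \<in> undecided - {x. 2 ^ e dvd x}"
    then have "2 ^ index x dvd x" by (simp add: undecided_def candidate_def)
    with x have "\<not> e \<le> index x" using dvd_trans[OF le_imp_power_dvd] by blast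
    with x show "x \<in> (\<Union>d<e. {x \<in> undecided. index x = d})" by simp
  qed
  then show "finite (undecided - {x. 2 ^ e dvd x})"
    by (rule finite_subset) (simp add: finite_undecided)
qed

lemma generically_computable_diag_set: "generically_computable diag_set"
proof -
  define P where "P s x = (if candidate x then if outcome (index x) x s = 0 then 1 else 0 else 0 :: nat)"
    for s x
  define G where "G s x = (if candidate x then if outcome (index x) x s = 1 then 1 else 0 else 0 :: nat)"
    for s x
  define \<Phi> where "\<Phi> x = (if \<exists>s. P s x = 0 then Some (G (LEAST s. P s x = 0) x) else None)" for x
  have "partial_computable \<Phi>"
    unfolding \<Phi>_def
  proof (rule partial_computable_search)
    show "recursive 2 (\<lambda>v. P (v 0) (v 1))"
      unfolding P_def by (intro recursive_intros) auto
    show "recursive 2 (\<lambda>v. G (v 0) (v 1))"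
      unfolding G_def by (intro recursive_intros) auto
  qed
  moreover have dom: "dom \<Phi> = - undecided"
    by (auto simp: dom_def \<Phi>_def undecided_def P_def split: if_splits)
  moreover have val: "\<Phi> x = Some (indicator diag_set x)" if "x \<in> dom \<Phi>" for x
  proof -
    have ex: "\<exists>s. P s x = 0" using that by (auto simp: \<Phi>_def split: if_splits)
    define s where "s = (LEAST s. P s x = 0)"
    have "P s x = 0" unfolding s_def by (rule LeastI_ex[OF ex])
    then have "outcome (index x) x s \<noteq> 0" if "candidate x"
      using that by (simp add: P_def split: if_splits)
    then have "x \<in> diag_set \<longleftrightarrow> candidate x \<and> outcome (index x) x s = 1"
      unfolding diag_set_def using outcome_eq_unique by blast
    then have "G s x = indicator diag_set x" by (simp add: G_def indicator_def)
    then show ?thesis using ex by (simp add: \<Phi>_def s_def)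
  qed
  moreover have "ran \<Phi> \<subseteq> {0, 1}"
    by (auto simp: ran_def \<Phi>_def G_def split: if_splits)
  moreover have "has_density (dom \<Phi>) 1"
    using density_undecided by (intro has_density_Compl) (simp add: dom)
  ultimately show ?thesis
    unfolding generically_computable_def generic_description_def by blast
qed

text \<open>
  A total function with code \<open>e\<close> has infinitely many active stages \<open>t\<close>; in each of the blocks \<open>(e, t)\<close>, the multiples of
  \<open>2 ^ e\<close> all belong to the symmetric difference.
\<close>

lemma not_coarsely_computable_diag_set: "\<not> coarsely_computable diag_set"
proof
  assume "coarsely_computable diag_set"
  then obtain C where C: "computable_set C" "has_density ((diag_set - C) \<union> (C - diag_set)) 0"
    unfolding coarsely_computable_def by blast
  obtain f where f: "\<And>x. computes f [x] (indicator C x)"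
    using C(1) unfolding computable_set_def partial_computable_def by auto
  define e where "e = code f"
  have out: "\<exists>s. outcome e x s = Suc (indicator C x)" for x
    using outcome_computes[OF f] unfolding e_def by blast
  have "\<not> has_density ((diag_set - C) \<union> (C - diag_set)) 0"
  proof (rule not_has_density_zeroI[of e])
    fix N
    obtain t where t: "t \<ge> N" "active e t"
      using infinite_active[of e N] out by (metis nat.distinct(1))
    have "{x. 2 ^ pair e t \<le> x \<and> x < 2 ^ Suc (pair e t) \<and> 2 ^ e dvd x}
        \<subseteq> (diag_set - C) \<union> (C - diag_set)"
    proof
      fix x :: nat
      assume x: "x \<in> {x. 2 ^ pair e t \<le> x \<and> x < 2 ^ Suc (pair e t) \<and> 2 ^ e dvd x}"
      then have "block x = pair e t" by (intro block_eq) blast+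
      then have "index x = e" "stage x = t" unfolding index_def stage_def by simp_all
      with x t have "x \<in> diag_set \<longleftrightarrow> (\<exists>s. outcome e x s = 1)"
        by (simp add: diag_set_def candidate_def)
      also have "\<dots> \<longleftrightarrow> x \<notin> C"
      proof -
        obtain s where s: "outcome e x s = Suc (indicator C x)" using out by blast
        then have "(\<exists>t. outcome e x t = 1) \<longleftrightarrow> outcome e x s = 1"
          by (intro outcome_eq_unique) simp
        with s show ?thesis by (simp add: indicator_def)
      qed
      finally show "x \<in> (diag_set - C) \<union> (C - diag_set)" by blast
    qed
    moreover have "N \<le> pair e t" using t le_prod_encode_2[of t e] by linarith
    ultimately show "\<exists>k\<ge>N. {x. 2 ^ k \<le> x \<and> x < 2 ^ Suc k \<and> 2 ^ e dvd x}
        \<subseteq> (diag_set - C) \<union> (C - diag_set)" by blast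
  qed
  with C(2) show False by simp
qed

theorem theorem2p26:
  "\<exists>A :: nat set. generically_computable A \<and> ce_set A \<and> \<not> coarsely_computable A"
  using generically_computable_diag_set ce_diag_set not_coarsely_computable_diag_set by blast

end
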